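(* A dynamical system $\langle\mathbb A,\alpha\rangle$ is incompressible if and only if the digraph $\langle\mathcal A,\to_\alpha\rangle$ is strongly connected for every partition $\mathcal A$ of $\mathbb A$.
   Context: A dynamical system is a Boolean algebra $\mathbb A$ with an automorphism $\alpha$; it is incompressible if no $x\in\mathbb A\setminus\{\mathbf 0,\mathbf 1\}$ has $\alpha(x)\le x$. A partition of $\mathbb A$ is a finite set of nonzero, pairwise disjoint elements whose join is $\mathbf 1$. For a partition $\mathcal A$, the digraph $\langle\mathcal A,\to_\alpha\rangle$ has vertex set $\mathcal A$ and $x\to_\alpha y$ iff $\alpha(x)\wedge y\neq\mathbf 0$. A digraph is strongly connected if for any vertices $a,b$ there is a walk (finite sequence of vertices, each related to the next by the edge relation) from $a$ to $b$. *)

theory Defs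
  imports "Graph_Theory.Digraph_Component_Vwalk"
begin

definition boolean_automorphism :: "('a::boolean_algebra \<Rightarrow> 'a) \<Rightarrow> bool" where
  "boolean_automorphism \<alpha> \<longleftrightarrow>
     bij \<alpha> \<and>
     (\<forall>x y. \<alpha> (inf x y) = inf (\<alpha> x) (\<alpha> y)) \<and>
     (\<forall>x y. \<alpha> (sup x y) = sup (\<alpha> x) (\<alpha> y)) \<and>
     (\<forall>x. \<alpha> (- x) = - \<alpha> x) \<and>
     \<alpha> bot = bot \<and> \<alpha> top = top"

definition incompressible :: "('a::boolean_algebra \<Rightarrow> 'a) \<Rightarrow> bool" where
  "incompressible \<alpha> \<longleftrightarrow> \<not> (\<exists>x. x \<notin> {bot, top} \<and> \<alpha> x \<le> x)"

text \<open>The join of a finite set. Unlike \<^const>\<open>Sup_fin\<close>, it is specified on the empty set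
  (as \<^const>\<open>bot\<close>); so the empty set is a partition exactly when the algebra is trivial.\<close>

definition finite_join :: "'a::boolean_algebra set \<Rightarrow> 'a" where
  "finite_join A = Finite_Set.fold sup bot A"

definition is_partition :: "'a::boolean_algebra set \<Rightarrow> bool" where
  "is_partition A \<longleftrightarrow>
     finite A \<and> bot \<notin> A \<and> pairwise (\<lambda>x y. inf x y = bot) A \<and> finite_join A = top"

definition partition_digraph ::
    "('a::boolean_algebra \<Rightarrow> 'a) \<Rightarrow> 'a set \<Rightarrow> ('a, 'a \<times> 'a) pre_digraph" where
  "partition_digraph \<alpha> A =
     \<lparr>verts = A, arcs = {(x, y). x \<in> A \<and> y \<in> A \<and> inf (\<alpha> x) y \<noteq> bot}, tail = fst, head = snd\<rparr>"

text \<open>\<^const>\<open>strongly_connected\<close> additionally demands a vertex. Here the empty digraph counts as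
  strongly connected; it arises as the digraph of the empty partition of the trivial algebra,
  whose only automorphism is incompressible.\<close>

definition walk_connected :: "('a, 'b) pre_digraph \<Rightarrow> bool" where
  "walk_connected G \<longleftrightarrow>
     (\<forall>a\<in>verts G. \<forall>b\<in>verts G. \<exists>p. vwalk p G \<and> hd p = a \<and> last p = b)"

lemma (in wf_digraph) walk_connected_iff_strongly_connected:
  assumes "verts G \<noteq> {}"
  shows "walk_connected G \<longleftrightarrow> strongly_connected G"
  using assms by (auto simp: walk_connected_def strongly_connected_def reachable_vwalk_conv)

end

theory Submission
  imports Defs
begin

text \<open>For a vertex \<open>a\<close> of a partition \<open>A\<close>, the join of the vertices reachable from \<open>a\<close> is compressed
  by \<open>\<alpha>\<close>, so incompressibility forces it to be \<open>top\<close>, and then disjointness forces every vertex to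
  be reachable. Conversely, a compressed \<open>x\<close> other than \<open>bot\<close> and \<open>top\<close> gives the partition
  \<open>{x, - x}\<close>, in which no arc leads from \<open>x\<close> to \<open>- x\<close>.\<close>

lemma finite_join_empty [simp]: "finite_join {} = bot"
  by (simp add: finite_join_def)

text \<open>Idempotence of \<open>sup\<close> covers the case that \<open>a\<close> already lies in
  \<open>A\<close>.\<close>

lemma finite_join_insert [simp]:
  assumes "finite A"
  shows "finite_join (insert a A) = sup a (finite_join A)"
proof -
  interpret comp_fun_idem "sup :: 'a \<Rightarrow> 'a \<Rightarrow> 'a"
    by (rule comp_fun_idem_sup)
  show ?thesis
    using assms by (simp add: finite_join_def)
qed

text \<open>Induction on \<open>A\<close>: \<open>f\<close> preserves \<open>bot\<close> and
  \<open>sup\<close>, so the bound splits at each insertion. With the identity for \<open>f\<close>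
  this is the universal property of the join; with \<alpha> it reduces compression of a join to its
  members.\<close>

lemma image_finite_join_le_iff:
  fixes f :: "'a::boolean_algebra \<Rightarrow> 'b::boolean_algebra"
  assumes "finite A" "f bot = bot" "\<And>x y. f (sup x y) = sup (f x) (f y)"
  shows "f (finite_join A) \<le> u \<longleftrightarrow> (\<forall>a\<in>A. f a \<le> u)"
  using assms(1) by induction (simp_all add: assms(2,3))

lemma finite_join_le_iff:
  "finite A \<Longrightarrow> finite_join A \<le> u \<longleftrightarrow> (\<forall>a\<in>A. a \<le> u)"
  using image_finite_join_le_iff[where f = "\<lambda>x. x"] by blast

lemma is_partition_complement:
  fixes x :: "'a::boolean_algebra"
  assumes "x \<noteq> bot" "x \<noteq> top"
  shows "is_partition {x, - x}"
proof -
  have "- x \<noteq> bot"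
    using assms(2) by (metis double_compl compl_bot_eq)
  thus ?thesis
    using assms(1) by (auto simp: is_partition_def pairwise_def)
qed

lemma wf_partition_digraph: "wf_digraph (partition_digraph \<alpha> A)"
  by unfold_locales (auto simp: partition_digraph_def)

lemma verts_partition_digraph [simp]: "verts (partition_digraph \<alpha> A) = A"
  by (simp add: partition_digraph_def)

lemma adj_partition_digraph:
  "x \<rightarrow>\<^bsub>partition_digraph \<alpha> A\<^esub> y \<longleftrightarrow> x \<in> A \<and> y \<in> A \<and> inf (\<alpha> x) y \<noteq> bot"
  by (auto simp: partition_digraph_def arcs_ends_def arc_to_ends_def)

text \<open>Passes from walks to reachability, which can be extended by one arc and comes with an
  induction rule.\<close>

lemma walk_connected_partition_digraph_iff:
  "walk_connected (partition_digraph \<alpha> A) \<longleftrightarrow>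
    (\<forall>a\<in>A. \<forall>b\<in>A. a \<rightarrow>\<^sup>*\<^bsub>partition_digraph \<alpha> A\<^esub> b)"
  by (auto simp: walk_connected_def wf_digraph.reachable_vwalk_conv[OF wf_partition_digraph])

text \<open>For \<open>r\<close> in \<open>R\<close>, the members of \<open>A\<close> that \<alpha>
  r meets are heads of arcs from \<open>r\<close>, hence lie in \<open>R\<close>. Since
  \<open>A\<close> joins to \<open>top\<close>, they cover \<alpha> r.\<close>

lemma compressed_join_reachable:
  fixes \<alpha> :: "'a::boolean_algebra \<Rightarrow> 'a" and a :: 'a
  assumes "boolean_automorphism \<alpha>" "is_partition A"
  defines "R \<equiv> {b. a \<rightarrow>\<^sup>*\<^bsub>partition_digraph \<alpha> A\<^esub> b}"
  shows "\<alpha> (finite_join R) \<le> finite_join R"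
proof -
  interpret wf_digraph "partition_digraph \<alpha> A"
    by (rule wf_partition_digraph)
  have fin: "finite A" and top: "finite_join A = top"
    using assms(2) by (auto simp: is_partition_def)
  have "R \<subseteq> A"
    unfolding R_def using reachable_in_verts(2) by fastforce
  hence finR: "finite R"
    using fin finite_subset by blast
  have "\<alpha> r \<le> finite_join R" if r: "r \<in> R" for r
  proof -
    \<comment> \<open>The goal is equivalent to this right-hand side being \<open>top\<close>, which
      can be tested on each member of \<open>A\<close> separately.\<close>
    have "y \<le> sup (finite_join R) (- \<alpha> r)" if "y \<in> A" for y
    proof (cases "y \<in> R")
      case True
      \<comment> \<open>With the join itself as the bound, the equivalence puts each member of
        \<open>R\<close> below the join.\<close>
      thus ?thesis
        using finite_join_le_iff[OF finR, of "finite_join R"] le_supI1 by blast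
    next
      case False
      have "\<not> r \<rightarrow>\<^bsub>partition_digraph \<alpha> A\<^esub> y"
        using False r reachable_adj_trans by (auto simp: R_def)
      hence "inf (\<alpha> r) y = bot"
        using r \<open>R \<subseteq> A\<close> \<open>y \<in> A\<close> by (auto simp: adj_partition_digraph)
      hence "y \<le> - \<alpha> r"
        by (simp add: inf_shunt inf.commute)
      thus ?thesis
        by (rule le_supI2)
    qed
    hence "sup (finite_join R) (- \<alpha> r) = top"
      using finite_join_le_iff[OF fin] by (simp add: top top.extremum_unique)
    thus ?thesis
      by (simp add: sup_shunt sup.commute)
  qed
  thus ?thesis
    using assms(1) finR by (subst image_finite_join_le_iff) (auto simp: boolean_automorphism_def)
qed

theorem theorem7p6:
  fixes \<alpha> :: "'a::boolean_algebra \<Rightarrow> 'a"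
  assumes "boolean_automorphism \<alpha>"
  shows "incompressible \<alpha> \<longleftrightarrow>
    (\<forall>A. is_partition A \<longrightarrow> walk_connected (partition_digraph \<alpha> A))"
proof
  assume inc: "incompressible \<alpha>"
  show "\<forall>A. is_partition A \<longrightarrow> walk_connected (partition_digraph \<alpha> A)"
  proof (intro allI impI, unfold walk_connected_partition_digraph_iff, intro ballI)
    fix A :: "'a set" and a b
    assume A: "is_partition A" and a: "a \<in> A" and b: "b \<in> A"
    interpret wf_digraph "partition_digraph \<alpha> A"
      by (rule wf_partition_digraph)
    define R where "R = {b. a \<rightarrow>\<^sup>*\<^bsub>partition_digraph \<alpha> A\<^esub> b}"
    have "R \<subseteq> A"
      unfolding R_def using reachable_in_verts(2) by fastforce
    hence finR: "finite R"
      using A finite_subset by (auto simp: is_partition_def)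
    \<comment> \<open>The trivial walk suffices. As \<open>a\<close> is not \<open>bot\<close>, this
      excludes \<open>bot\<close> as the value of the compressed join.\<close>
    have "a \<in> R"
      using a by (simp add: R_def)
    hence "a \<le> finite_join R"
      using finite_join_le_iff[OF finR, of "finite_join R"] by blast
    hence "finite_join R \<noteq> bot"
      using a A by (auto simp: is_partition_def bot.extremum_unique)
    hence top: "finite_join R = top"
      using inc compressed_join_reachable[OF assms A, of a]
      by (auto simp: incompressible_def R_def)
    show "a \<rightarrow>\<^sup>*\<^bsub>partition_digraph \<alpha> A\<^esub> b"
    proof (rule ccontr)
      assume "\<not> a \<rightarrow>\<^sup>*\<^bsub>partition_digraph \<alpha> A\<^esub> b"
      hence "b \<notin> R"
        by (simp add: R_def)
      \<comment> \<open>An unreachable \<open>b\<close> is disjoint from every member of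
        \<open>R\<close>, hence from their join \<open>top\<close>.\<close>
      have "inf r b = bot" if "r \<in> R" for r
        using A b \<open>R \<subseteq> A\<close> that \<open>b \<notin> R\<close>
        by (auto simp: is_partition_def intro: pairwiseD)
      hence "finite_join R \<le> - b"
        by (simp add: finite_join_le_iff[OF finR] inf_shunt)
      hence "- b = top"
        by (simp add: top top.extremum_unique)
      hence "b = bot"
        by (metis double_compl compl_top_eq)
      thus False
        using A b by (simp add: is_partition_def)
    qed
  qed
next
  assume conn: "\<forall>A. is_partition A \<longrightarrow> walk_connected (partition_digraph \<alpha> A)"
  show "incompressible \<alpha>"
    unfolding incompressible_def
  proof
    assume "\<exists>x. x \<notin> {bot, top} \<and> \<alpha> x \<le> x"
    then obtain x where x: "x \<noteq> bot" "x \<noteq> top" "\<alpha> x \<le> x"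
      by auto
    let ?G = "partition_digraph \<alpha> {x, - x}"
    interpret wf_digraph ?G
      by (rule wf_partition_digraph)
    have no_arc: "inf (\<alpha> x) (- x) = bot"
      using x(3) by (simp add: inf_shunt)
    \<comment> \<open>A walk from \<open>x\<close> never leaves \<open>x\<close>, since the only
      other vertex is \<open>- x\<close> and \<open>no_arc\<close> forbids that step.\<close>
    have "y = x" if "x \<rightarrow>\<^sup>*\<^bsub>?G\<^esub> y" for y
      using that
      by (induction rule: reachable_induct) (use no_arc in \<open>auto simp: adj_partition_digraph\<close>)
    moreover have "x \<rightarrow>\<^sup>*\<^bsub>?G\<^esub> (- x)"
      using conn is_partition_complement[OF x(1,2)]
      by (simp add: walk_connected_partition_digraph_iff)
    ultimately have "- x = x"
      by blast
    \<comment> \<open>If \<open>- x = x\<close>, then \<open>inf x (- x)\<close> is both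
      \<open>x\<close> and \<open>bot\<close>.\<close>
    hence "x = bot"
      using inf_compl_bot[of x] by simp
    with x(1) show False ..
  qed
qed

end
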